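(* Let $M$ and $N$ be uniform matroids of rank $1$ with disjoint ground sets $A=\{a_1,\dots,a_n\}$ and $B=\{b_1,\dots,b_n\}$, respectively, and let $E=A\cup B$. Let $\Gamma=\{\{a_i,b_j\}:i,j=1,\dots,n\}$ be the base family of the direct sum $M\oplus N$, and let $\eta^*$ be the universal density of $M\oplus N$, so $\eta^*(e)=1/n$ for every $e\in E$. Let $F$ be the set of all bijections $f:A\to B$, and for $f\in F$ let $\mu_f\in\mathcal P(\Gamma)$ be the probability mass function that is uniform on $\{\{a_i,f(a_i)\}:i=1,\dots,n\}$. Then a probability mass function $\mu\in\mathcal P(\Gamma)$ induces $\eta^*$ if and only if $\mu\in\operatorname{conv}(\{\mu_f:f\in F\})$.
   Context: $\mathcal P(\Gamma)$ is the set of probability mass functions on $\Gamma$, viewed as vectors in $\mathbb R^\Gamma_{\ge0}$. A pmf $\mu\in\mathcal P(\Gamma)$ induces $\eta^*$ if $\sum_{\gamma\in\Gamma:\,e\in\gamma}\mu(\gamma)=\eta^*(e)$ for all $e\in E$. The universal density of an (unweighted) matroid is the unique minimizer of $\sum_{e\in E}\eta(e)^2$ over the convex hull of the indicator vectors of its bases. $\operatorname{conv}$ denotes convex hull. The direct sum $M\oplus N$ has as independent sets the unions of an independent set of $M$ and one of $N$. *)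

theory Defs
  imports "HOL-Probability.Probability" "HOL-Library.Function_Algebras"
begin

text \<open>
  The vector space of all real functions on a type, with pointwise operations, so that the
  library's \<open>convex hull\<close> applies to functions. A vector indexed by a set \<open>S\<close> is represented by
  a function on the whole type that vanishes outside \<open>S\<close>.
\<close>

instantiation "fun" :: (type, real_vector) real_vector
begin

definition scaleR_fun :: "real \<Rightarrow> ('a \<Rightarrow> 'b) \<Rightarrow> 'a \<Rightarrow> 'b"
  where "scaleR_fun c f = (\<lambda>x. c *\<^sub>R f x)"

instance
  by standard (simp_all add: scaleR_fun_def fun_eq_iff algebra_simps)

end

lemma scaleR_fun_apply [simp]: "(c *\<^sub>R f) x = c *\<^sub>R f x"
  by (simp add: scaleR_fun_def)

record 'a matroid_data =
  ground :: "'a set"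
  indeps :: "'a set set"

definition matroid :: "'a matroid_data \<Rightarrow> bool"
  where "matroid M \<longleftrightarrow>
    finite (ground M) \<and> indeps M \<subseteq> Pow (ground M) \<and> {} \<in> indeps M \<and>
    (\<forall>I\<in>indeps M. \<forall>J. J \<subseteq> I \<longrightarrow> J \<in> indeps M) \<and>
    (\<forall>I\<in>indeps M. \<forall>J\<in>indeps M. card I < card J \<longrightarrow> (\<exists>x\<in>J - I. insert x I \<in> indeps M))"

definition bases :: "'a matroid_data \<Rightarrow> 'a set set"
  where "bases M = {B \<in> indeps M. \<forall>I\<in>indeps M. B \<subseteq> I \<longrightarrow> I = B}"

text \<open>The uniform matroid has rank \<open>r\<close> only if \<open>r \<le> card E\<close>.\<close>

definition uniform_matroid :: "nat \<Rightarrow> 'a set \<Rightarrow> 'a matroid_data"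
  where "uniform_matroid r E =
    \<lparr>ground = E, indeps = {I. I \<subseteq> E \<and> card I \<le> r}\<rparr>"

text \<open>Meaningful for matroids with disjoint ground sets.\<close>

definition direct_sum :: "'a matroid_data \<Rightarrow> 'a matroid_data \<Rightarrow> 'a matroid_data"
  where "direct_sum M N =
    \<lparr>ground = ground M \<union> ground N, indeps = {I \<union> J | I J. I \<in> indeps M \<and> J \<in> indeps N}\<rparr>"

definition base_polytope :: "'a matroid_data \<Rightarrow> ('a \<Rightarrow> real) set"
  where "base_polytope M = convex hull ((indicator :: 'a set \<Rightarrow> 'a \<Rightarrow> real) ` bases M)"

definition universal_density :: "'a matroid_data \<Rightarrow> 'a \<Rightarrow> real"
  where "universal_density M =
    (THE \<eta>. is_arg_min (\<lambda>\<eta>. \<Sum>e\<in>ground M. (\<eta> e)\<^sup>2) (\<lambda>\<eta>. \<eta> \<in> base_polytope M) \<eta>)"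

text \<open>
  The set \<open>\<P>(\<Gamma>)\<close>; the vector of a probability mass function \<open>\<mu>\<close> is \<open>pmf \<mu>\<close>, which vanishes
  outside \<open>\<Gamma>\<close>.
\<close>

definition pmfs_on :: "'b set \<Rightarrow> 'b pmf set"
  where "pmfs_on \<Gamma> = {\<mu>. set_pmf \<mu> \<subseteq> \<Gamma>}"

definition induces :: "'a set \<Rightarrow> 'a set set \<Rightarrow> 'a set pmf \<Rightarrow> ('a \<Rightarrow> real) \<Rightarrow> bool"
  where "induces E \<Gamma> \<mu> \<eta> \<longleftrightarrow> (\<forall>e\<in>E. (\<Sum>\<gamma>\<in>{\<gamma>\<in>\<Gamma>. e \<in> \<gamma>}. pmf \<mu> \<gamma>) = \<eta> e)"

definition matching_pmf :: "'a set \<Rightarrow> ('a \<Rightarrow> 'a) \<Rightarrow> 'a set pmf"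
  where "matching_pmf A f = pmf_of_set {{x, f x} | x. x \<in> A}"

lemma matroid_uniform_matroid:
  assumes "finite E"
  shows "matroid (uniform_matroid r E)"
proof -
  let ?U = "uniform_matroid r E"
  have ind: "I \<in> indeps ?U \<longleftrightarrow> I \<subseteq> E \<and> card I \<le> r" for I
    by (simp add: uniform_matroid_def)
  have "\<exists>x\<in>J - I. insert x I \<in> indeps ?U"
    if I: "I \<in> indeps ?U" and J: "J \<in> indeps ?U" and lt: "card I < card J" for I J
  proof -
    have fin: "finite I" "finite J" using I J ind assms finite_subset by blast+
    have "\<not> J \<subseteq> I" using fin lt card_mono by (metis linorder_not_le)
    then obtain x where "x \<in> J - I" by blast
    with I J lt fin show ?thesis by (intro bexI[of _ x]) (auto simp: ind)
  qed
  moreover have "J \<in> indeps ?U" if "I \<in> indeps ?U" "J \<subseteq> I" for I J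
    using that assms ind by (meson card_mono finite_subset le_trans subset_trans)
  moreover have "finite (ground ?U)" "indeps ?U \<subseteq> Pow (ground ?U)" "{} \<in> indeps ?U"
    using assms by (auto simp: uniform_matroid_def)
  ultimately show ?thesis
    unfolding matroid_def by (intro conjI ballI allI impI)
qed

lemma bases_uniform_matroid:
  assumes "finite E" "r \<le> card E"
  shows "bases (uniform_matroid r E) = {B. B \<subseteq> E \<and> card B = r}"
proof (intro equalityI subsetI)
  fix B assume B: "B \<in> bases (uniform_matroid r E)"
  then have "B \<subseteq> E" "card B \<le> r" by (auto simp: bases_def uniform_matroid_def)
  moreover have "card B = r"
  proof (rule ccontr)
    assume "card B \<noteq> r"
    with \<open>card B \<le> r\<close> have lt: "card B < r" by simp
    have "finite B" using \<open>B \<subseteq> E\<close> assms(1) finite_subset by blast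
    moreover have "B \<noteq> E" using lt assms(2) by auto
    then obtain x where "x \<in> E - B" using \<open>B \<subseteq> E\<close> by blast
    ultimately show False
      using B lt \<open>B \<subseteq> E\<close>
      by (auto simp: bases_def uniform_matroid_def dest!: spec[of _ "insert x B"])
  qed
  ultimately show "B \<in> {B. B \<subseteq> E \<and> card B = r}" by simp
next
  fix B assume B: "B \<in> {B. B \<subseteq> E \<and> card B = r}"
  have "I = B" if "I \<subseteq> E" "card I \<le> r" "B \<subseteq> I" for I
    using card_seteq[of I B] that B assms(1) finite_subset by auto
  with B show "B \<in> bases (uniform_matroid r E)"
    by (auto simp: bases_def uniform_matroid_def)
qed

lemma matroid_direct_sum:
  assumes M: "matroid M" and N: "matroid N" and disj: "ground M \<inter> ground N = {}"
  shows "matroid (direct_sum M N)"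
proof -
  let ?S = "direct_sum M N"
  note D = matroid_def[THEN iffD1]
  have grM: "I \<subseteq> ground M" "finite I" if "I \<in> indeps M" for I
    using D[OF M] that by (auto intro: finite_subset)
  have grN: "I \<subseteq> ground N" "finite I" if "I \<in> indeps N" for I
    using D[OF N] that by (auto intro: finite_subset)
  have dis: "I \<inter> J = {}" if "I \<in> indeps M" "J \<in> indeps N" for I J
    using grM(1)[OF that(1)] grN(1)[OF that(2)] disj by blast
  have indI: "I \<union> J \<in> indeps ?S" if "I \<in> indeps M" "J \<in> indeps N" for I J
    using that by (auto simp: direct_sum_def)
  have indE: thesis
    if "K \<in> indeps ?S" "\<And>I J. K = I \<union> J \<Longrightarrow> I \<in> indeps M \<Longrightarrow> J \<in> indeps N \<Longrightarrow> thesis" for K thesis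
    using that by (auto simp: direct_sum_def)
  have gr: "ground ?S = ground M \<union> ground N"
    by (simp add: direct_sum_def)
  have subM: "\<And>I J. I \<in> indeps M \<Longrightarrow> J \<subseteq> I \<Longrightarrow> J \<in> indeps M"
    and subN: "\<And>I J. I \<in> indeps N \<Longrightarrow> J \<subseteq> I \<Longrightarrow> J \<in> indeps N"
    using D[OF M] D[OF N] by metis+
  have empty: "{} \<in> indeps M" "{} \<in> indeps N"
    using D[OF M] D[OF N] by simp_all
  have "finite (ground ?S)" using M N gr by (simp add: matroid_def)
  moreover have "indeps ?S \<subseteq> Pow (ground ?S)"
    using grM(1) grN(1) gr by (auto elim!: indE)
  moreover have "{} \<in> indeps ?S"
    using indI[OF empty] by simp
  moreover have "J \<in> indeps ?S" if IS: "I \<in> indeps ?S" and sub: "J \<subseteq> I" for I J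
  proof -
    obtain I1 I2 where I: "I = I1 \<union> I2" "I1 \<in> indeps M" "I2 \<in> indeps N"
      using IS by (rule indE)
    have "J = (J \<inter> I1) \<union> (J \<inter> I2)" using sub I(1) by blast
    moreover have "J \<inter> I1 \<in> indeps M" "J \<inter> I2 \<in> indeps N"
      using subM[OF I(2)] subN[OF I(3)] by simp_all
    ultimately show ?thesis using indI by metis
  qed
  moreover have "\<exists>x\<in>J - I. insert x I \<in> indeps ?S"
    if IS: "I \<in> indeps ?S" and JS: "J \<in> indeps ?S" and lt: "card I < card J" for I J
  proof -
    obtain I1 I2 where I: "I = I1 \<union> I2" "I1 \<in> indeps M" "I2 \<in> indeps N"
      using IS by (rule indE)
    obtain J1 J2 where J: "J = J1 \<union> J2" "J1 \<in> indeps M" "J2 \<in> indeps N"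
      using JS by (rule indE)
    have "card I = card I1 + card I2" "card J = card J1 + card J2"
      using card_Un_disjoint[OF grM(2)[OF I(2)] grN(2)[OF I(3)] dis[OF I(2,3)]]
        card_Un_disjoint[OF grM(2)[OF J(2)] grN(2)[OF J(3)] dis[OF J(2,3)]]
      unfolding I(1) J(1) .
    with lt consider "card I1 < card J1" | "card I2 < card J2" by linarith
    then show ?thesis
    proof cases
      case 1
      then obtain x where x: "x \<in> J1 - I1" "insert x I1 \<in> indeps M"
        using D[OF M] I(2) J(2) by metis
      have "x \<notin> I2" using dis[OF J(2) I(3)] dis[OF x(2) I(3)] x(1) by blast
      then have "x \<in> J - I" using x(1) I(1) J(1) by blast
      moreover have "insert x I \<in> indeps ?S" using indI[OF x(2) I(3)] I(1) by simp
      ultimately show ?thesis by (rule bexI[rotated])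
    next
      case 2
      then obtain x where x: "x \<in> J2 - I2" "insert x I2 \<in> indeps N"
        using D[OF N] I(3) J(3) by metis
      have "x \<notin> I1" using dis[OF I(2) x(2)] by blast
      then have "x \<in> J - I" using x(1) I(1) J(1) by blast
      moreover have "insert x I \<in> indeps ?S" using indI[OF I(2) x(2)] I(1) by simp
      ultimately show ?thesis by (rule bexI[rotated])
    qed
  qed
  ultimately show ?thesis unfolding matroid_def by (intro conjI ballI allI impI)
qed

end

theory Submission
  imports Defs
begin

text \<open>
  A base of the direct sum is a pair \<open>{x, y}\<close> with \<open>x \<in> A\<close> and \<open>y \<in> B\<close>, so a probability mass
  function \<open>\<mu>\<close> on bases is the same as a nonnegative matrix \<open>p (x, y) = \<mu> {x, y}\<close> indexed by
  \<open>A \<times> B\<close>. The usage of \<open>x \<in> A\<close> is a row sum of this matrix, and the usage of \<open>y \<in> B\<close> is a column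
  sum. The universal density is constant with value \<open>1 / n\<close>, because the squares of numbers with
  prescribed sum have least total when the numbers are equal. Hence \<open>\<mu>\<close> induces it exactly when
  \<open>n\<close> times its matrix is doubly stochastic (\<open>induces_uniform_iff_doubly_stochastic\<close>).

  In the same dictionary \<open>\<mu>\<^sub>f\<close> is the permutation matrix of \<open>f\<close> divided by \<open>n\<close>. The claim is therefore
  the theorem of Birkhoff and von Neumann, that the doubly stochastic matrices are the convex
  combinations of the permutation matrices, carried over by a linear map
  (\<open>induces_uniform_iff_in_hull\<close>). The theorem follows from Hall's marriage theorem: the
  support of a doubly stochastic matrix contains a perfect matching, whose permutation matrix can be
  split off with a weight that makes an entry vanish, and the rest has smaller support.
\<close>

section \<open>Systems of distinct representatives\<close>

text \<open>
  Rado's argument by shrinking the sets. If all sets are singletons, Hall's condition on pairs makes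
  them disjoint. Otherwise some \<open>N x\<close> has two elements \<open>y\<close> and \<open>z\<close>, and one of them can be
  deleted without loss: if both deletions violated the condition, submodularity of the cardinality,
  applied to the two violating unions, would contradict the condition for the original sets.
\<close>

theorem hall_marriage:
  fixes N :: "'a \<Rightarrow> 'b set"
  assumes "finite A" and "\<And>x. x \<in> A \<Longrightarrow> finite (N x)"
    and "\<And>X. X \<subseteq> A \<Longrightarrow> card X \<le> card (\<Union>(N ` X))"
  shows "\<exists>f. inj_on f A \<and> (\<forall>x\<in>A. f x \<in> N x)"
  using assms(2,3)
proof (induction "\<Sum>x\<in>A. card (N x)" arbitrary: N rule: less_induct)
  case less
  note finN = less.prems(1) and hall = less.prems(2)
  show ?case
  proof (cases "\<exists>x\<in>A. \<exists>y\<in>N x. \<exists>z\<in>N x. y \<noteq> z")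
    case False
    have "N x \<noteq> {}" if "x \<in> A" for x
      using hall[of "{x}"] that by auto
    then have "\<forall>x\<in>A. \<exists>y. y \<in> N x" by blast
    then obtain f where f: "\<And>x. x \<in> A \<Longrightarrow> f x \<in> N x"
      by (metis (no_types))
    have single: "N x = {f x}" if "x \<in> A" for x
      using False f[OF that] that by auto
    have "inj_on f A"
    proof (rule inj_onI, rule ccontr)
      fix x x' assume x: "x \<in> A" "x' \<in> A" "f x = f x'" "x \<noteq> x'"
      then have "card {x, x'} \<le> card (\<Union>(N ` {x, x'}))"
        by (intro hall) auto
      moreover have "\<Union>(N ` {x, x'}) = {f x}"
        using x single by auto
      ultimately show False using x(4) by simp
    qed
    then show ?thesis using f by blast
  next
    case True
    then obtain x y z where x: "x \<in> A" and yz: "y \<in> N x" "z \<in> N x" "y \<noteq> z"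
      by blast
    define R where "R w = N(x := N x - {w})" for w
    have finU: "finite (\<Union>(N ` X))" if "X \<subseteq> A" for X
      using that finN finite_subset[OF that assms(1)] by auto
    \<comment> \<open>The smaller family has no representatives either, so by induction some index set \<open>Y\<close> violates
      the condition for it. Only the set at \<open>x\<close> has changed, so \<open>x \<in> Y\<close>; the witness is
      \<open>Y - {x}\<close>.\<close>
    have tight: "\<exists>X\<subseteq>A - {x}. card (\<Union>(N ` X) \<union> (N x - {w})) \<le> card X"
      if w: "w \<in> N x" and no: "\<not> (\<exists>f. inj_on f A \<and> (\<forall>v\<in>A. f v \<in> N v))" for w
    proof -
      have "(\<Sum>v\<in>A. card (R w v)) < (\<Sum>v\<in>A. card (N v))"
      proof (rule sum_strict_mono_ex1[OF assms(1)])
        show "\<forall>v\<in>A. card (R w v) \<le> card (N v)"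
          using finN by (auto simp: R_def intro: card_mono)
        show "\<exists>v\<in>A. card (R w v) < card (N v)"
          using card_Diff1_less[OF finN[OF x] w]
          by (intro bexI[OF _ x]) (simp only: R_def fun_upd_same)
      qed
      moreover have "finite (R w v)" if "v \<in> A" for v
        using finN that x by (auto simp: R_def)
      moreover have "\<not> (\<exists>f. inj_on f A \<and> (\<forall>v\<in>A. f v \<in> R w v))"
      proof
        assume "\<exists>f. inj_on f A \<and> (\<forall>v\<in>A. f v \<in> R w v)"
        then obtain f where "inj_on f A" "\<forall>v\<in>A. f v \<in> R w v" by blast
        moreover have "R w v \<subseteq> N v" for v by (auto simp: R_def)
        ultimately show False using no by blast
      qed
      ultimately obtain Y where Y: "Y \<subseteq> A" "card (\<Union>(R w ` Y)) < card Y"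
        using less.hyps[of "R w"] by (meson not_le)
      have xY: "x \<in> Y"
      proof (rule ccontr)
        assume "x \<notin> Y"
        then have "\<Union>(R w ` Y) = \<Union>(N ` Y)" by (auto simp: R_def)
        then show False using hall[OF Y(1)] Y(2) by simp
      qed
      have "\<Union>(R w ` Y) = \<Union>(N ` (Y - {x})) \<union> (N x - {w})"
        using xY by (auto simp: R_def split: if_splits)
      moreover have "card Y = Suc (card (Y - {x}))"
        using card_Suc_Diff1 xY Y(1) assms(1) finite_subset by metis
      ultimately show ?thesis using Y by (intro exI[of _ "Y - {x}"]) auto
    qed
    show ?thesis
    proof (rule ccontr)
      assume no: "\<not> ?thesis"
      obtain X where X: "X \<subseteq> A - {x}" "card (\<Union>(N ` X) \<union> (N x - {y})) \<le> card X"
        using tight[OF yz(1) no] by blast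
      obtain Z where Z: "Z \<subseteq> A - {x}" "card (\<Union>(N ` Z) \<union> (N x - {z})) \<le> card Z"
        using tight[OF yz(2) no] by blast
      define U where "U = \<Union>(N ` X) \<union> (N x - {y})"
      define V where "V = \<Union>(N ` Z) \<union> (N x - {z})"
      have finXZ: "finite X" "finite Z"
        using X Z assms(1) by (meson finite_Diff finite_subset)+
      have finUV: "finite U" "finite V"
        using X(1) Z(1) finU[of X] finU[of Z] finN[OF x] by (auto simp: U_def V_def)
      \<comment> \<open>The deleted elements differ, so each is restored by the other union.\<close>
      have "U \<union> V = \<Union>(N ` insert x (X \<union> Z))"
        using yz by (auto simp: U_def V_def)
      moreover have "card (insert x (X \<union> Z)) \<le> card (\<Union>(N ` insert x (X \<union> Z)))"
        using X Z x by (intro hall) auto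
      ultimately have "Suc (card (X \<union> Z)) \<le> card (U \<union> V)"
        using X Z finXZ by (subst (asm) card_insert_disjoint) auto
      moreover have "card (X \<inter> Z) \<le> card (\<Union>(N ` (X \<inter> Z)))"
        using X by (intro hall) auto
      moreover have "card (\<Union>(N ` (X \<inter> Z))) \<le> card (U \<inter> V)"
        using finUV by (intro card_mono) (auto simp: U_def V_def)
      ultimately show False
        using X(2) Z(2) card_Un_Int[OF finXZ] card_Un_Int[OF finUV]
        unfolding U_def[symmetric] V_def[symmetric] by linarith
    qed
  qed
qed

section \<open>Doubly stochastic matrices\<close>

definition perm_matrix :: "'a set \<Rightarrow> ('a \<Rightarrow> 'b) \<Rightarrow> 'a \<times> 'b \<Rightarrow> real"
  where "perm_matrix A f = (\<lambda>(x, y). if x \<in> A \<and> y = f x then 1 else 0)"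

text \<open>
  Vanishing outside \<open>A \<times> B\<close> makes a matrix a unique point of the function space, so that its
  convex decompositions are equalities of functions.
\<close>

definition doubly_stochastic :: "'a set \<Rightarrow> 'b set \<Rightarrow> ('a \<times> 'b \<Rightarrow> real) \<Rightarrow> bool"
  where "doubly_stochastic A B p \<longleftrightarrow>
    (\<forall>z. 0 \<le> p z) \<and> (\<forall>z. z \<notin> A \<times> B \<longrightarrow> p z = 0) \<and>
    (\<forall>x\<in>A. (\<Sum>y\<in>B. p (x, y)) = 1) \<and> (\<forall>y\<in>B. (\<Sum>x\<in>A. p (x, y)) = 1)"

lemma doubly_stochastic_perm_matrix:
  assumes "finite A" "finite B" "bij_betw f A B"
  shows "doubly_stochastic A B (perm_matrix A f)"
proof -
  have fB: "f x \<in> B" if "x \<in> A" for x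
    using assms(3) that by (auto simp: bij_betw_def)
  have "(\<Sum>x\<in>A. perm_matrix A f (x, y)) = 1" if "y \<in> B" for y
  proof -
    obtain x0 where x0: "x0 \<in> A" "y = f x0"
      using assms(3) \<open>y \<in> B\<close> by (auto simp: bij_betw_def)
    have "(\<Sum>x\<in>A. perm_matrix A f (x, y)) = (\<Sum>x\<in>A. if x = x0 then 1 else 0)"
      using assms(3) x0 by (intro sum.cong) (auto simp: perm_matrix_def bij_betw_def inj_on_def)
    then show ?thesis using x0 assms(1) by simp
  qed
  moreover have "(\<Sum>y\<in>B. perm_matrix A f (x, y)) = 1" if "x \<in> A" for x
    using that fB[OF that] assms(2) by (simp add: perm_matrix_def)
  ultimately show ?thesis
    using fB by (auto simp: doubly_stochastic_def perm_matrix_def)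
qed

text \<open>
  Hall's condition holds by double counting: the rows in \<open>X\<close> carry total mass \<open>card X\<close>, all of it in
  the columns that meet the support in such a row, and these columns carry no more than their number.
  The total mass also shows that \<open>A\<close> and \<open>B\<close> have equally many elements, so that an injective
  choice is bijective.
\<close>

lemma doubly_stochastic_support_matching:
  assumes fin: "finite A" "finite B" and p: "doubly_stochastic A B p"
  shows "\<exists>f. bij_betw f A B \<and> (\<forall>x\<in>A. 0 < p (x, f x))"
proof -
  define N where "N x = {y \<in> B. 0 < p (x, y)}" for x
  have nn: "0 \<le> p z" and rows: "x \<in> A \<Longrightarrow> (\<Sum>y\<in>B. p (x, y)) = 1"
    and cols: "y \<in> B \<Longrightarrow> (\<Sum>x\<in>A. p (x, y)) = 1" for x y z
    using p unfolding doubly_stochastic_def by blast+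
  have "\<exists>f. inj_on f A \<and> (\<forall>x\<in>A. f x \<in> N x)"
  proof (rule hall_marriage[OF fin(1)])
    show "finite (N x)" for x using fin by (simp add: N_def)
    fix X assume X: "X \<subseteq> A"
    let ?U = "\<Union>(N ` X)"
    have U: "?U \<subseteq> B" by (auto simp: N_def)
    have "real (card X) = (\<Sum>x\<in>X. \<Sum>y\<in>B. p (x, y))"
      using X rows by (simp add: subset_iff)
    also have "\<dots> = (\<Sum>x\<in>X. \<Sum>y\<in>?U. p (x, y))"
    proof (rule sum.cong[OF refl], rule sum.mono_neutral_right[OF fin(2) U], rule ballI)
      fix x y assume "x \<in> X" "y \<in> B - ?U"
      then have "\<not> 0 < p (x, y)" by (auto simp: N_def)
      then show "p (x, y) = 0" using nn[of "(x, y)"] by linarith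
    qed
    also have "\<dots> \<le> (\<Sum>x\<in>A. \<Sum>y\<in>?U. p (x, y))"
      using X fin nn by (intro sum_mono2) (auto intro: sum_nonneg)
    also have "\<dots> = (\<Sum>y\<in>?U. \<Sum>x\<in>A. p (x, y))" by (rule sum.swap)
    also have "\<dots> = real (card ?U)" using U cols by (simp add: subset_iff)
    finally show "card X \<le> card ?U" by simp
  qed
  then obtain f where f: "inj_on f A" "\<And>x. x \<in> A \<Longrightarrow> f x \<in> N x" by blast
  have "real (card A) = (\<Sum>x\<in>A. \<Sum>y\<in>B. p (x, y))" using rows by simp
  also have "\<dots> = (\<Sum>y\<in>B. \<Sum>x\<in>A. p (x, y))" by (rule sum.swap)
  also have "\<dots> = real (card B)" using cols by simp
  finally have "card (f ` A) = card B" using card_image[OF f(1)] by simp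
  moreover have "f ` A \<subseteq> B" using f(2) by (auto simp: N_def)
  ultimately have "f ` A = B" using card_subset_eq[OF fin(2)] by blast
  with f show ?thesis by (auto simp: bij_betw_def N_def)
qed

text \<open>
  Induction on the size of the support. Let \<open>m\<close> be the least entry of \<open>p\<close> on a perfect matching \<open>f\<close>
  inside the support. If \<open>m < 1\<close>, then \<open>p = m P + (1 - m) q\<close> where \<open>P\<close> is the permutation matrix of
  \<open>f\<close> and \<open>q\<close> is doubly stochastic with smaller support; otherwise the row sums force \<open>p = P\<close>.
\<close>

theorem birkhoff_von_neumann:
  assumes fin: "finite A" "finite B" and p: "doubly_stochastic A B p"
  shows "p \<in> convex hull (perm_matrix A ` {f. bij_betw f A B})"
  using p
proof (induction "card {z \<in> A \<times> B. 0 < p z}" arbitrary: p rule: less_induct)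
  case less
  note p = less.prems
  have nn: "0 \<le> p z" and out: "z \<notin> A \<times> B \<Longrightarrow> p z = 0"
    and rows: "x \<in> A \<Longrightarrow> (\<Sum>y\<in>B. p (x, y)) = 1"
    and cols: "y \<in> B \<Longrightarrow> (\<Sum>x\<in>A. p (x, y)) = 1" for x y z
    using p unfolding doubly_stochastic_def by blast+
  obtain f where f: "bij_betw f A B" and pos: "\<And>x. x \<in> A \<Longrightarrow> 0 < p (x, f x)"
    using doubly_stochastic_support_matching[OF fin p] by blast
  let ?P = "perm_matrix A f" and ?H = "convex hull (perm_matrix A ` {f. bij_betw f A B})"
  have PH: "?P \<in> ?H" using f by (intro hull_inc) auto
  have P: "doubly_stochastic A B ?P"
    by (rule doubly_stochastic_perm_matrix[OF fin f])
  have fB: "f x \<in> B" if "x \<in> A" for x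
    using f that by (auto simp: bij_betw_def)
  show ?case
  proof (cases "\<forall>x\<in>A. 1 \<le> p (x, f x)")
    case True
    have "p (x, y) = ?P (x, y)" for x y
    proof (cases "x \<in> A \<and> y \<in> B")
      case xy: True
      have split: "1 = p (x, f x) + (\<Sum>y\<in>B - {f x}. p (x, y))"
        using rows[of x] xy fB fin by (subst sum.remove[symmetric]) auto
      have ge: "0 \<le> (\<Sum>y\<in>B - {f x}. p (x, y))" using nn by (simp add: sum_nonneg)
      have "1 \<le> p (x, f x)" using True xy by blast
      with split ge have one: "p (x, f x) = 1" and "(\<Sum>y\<in>B - {f x}. p (x, y)) = 0" by linarith+
      then have "\<forall>y\<in>B - {f x}. p (x, y) = 0"
        using nn fin by (subst (asm) sum_nonneg_eq_0_iff) auto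
      with one xy show ?thesis by (auto simp: perm_matrix_def)
    next
      case False
      then show ?thesis using out fB by (auto simp: perm_matrix_def)
    qed
    then have "p = ?P" by auto
    with PH show ?thesis by simp
  next
    case False
    define m where "m = Min ((\<lambda>x. p (x, f x)) ` A)"
    have "A \<noteq> {}" using False by auto
    then have "m \<in> (\<lambda>x. p (x, f x)) ` A"
      using fin unfolding m_def by (intro Min_in) auto
    then obtain x0 where x0: "x0 \<in> A" "m = p (x0, f x0)" by auto
    have le: "m \<le> p (x, f x)" if "x \<in> A" for x
      using that fin by (auto simp: m_def)
    have m0: "0 < m" using pos x0 by simp
    have m1: "m < 1" using False le by force
    define q where "q = (\<lambda>z. (p z - m * ?P z) / (1 - m))"
    have qds: "doubly_stochastic A B q"
      unfolding doubly_stochastic_def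
    proof (intro conjI allI ballI impI)
      fix z show "0 \<le> q z"
        using nn[of z] le m1 by (cases z) (auto simp: q_def perm_matrix_def)
    next
      fix z assume "z \<notin> A \<times> B"
      then show "q z = 0"
        using out[of z] P by (cases z) (simp add: q_def doubly_stochastic_def)
    next
      fix x assume x: "x \<in> A"
      then show "(\<Sum>y\<in>B. q (x, y)) = 1"
        using rows P m1
        by (simp add: q_def doubly_stochastic_def sum_subtractf
            flip: sum_divide_distrib sum_distrib_left)
    next
      fix y assume y: "y \<in> B"
      then show "(\<Sum>x\<in>A. q (x, y)) = 1"
        using cols P m1
        by (simp add: q_def doubly_stochastic_def sum_subtractf
            flip: sum_divide_distrib sum_distrib_left)
    qed
    have sub: "{z \<in> A \<times> B. 0 < q z} \<subset> {z \<in> A \<times> B. 0 < p z}"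
    proof (rule psubsetI)
      have "0 < p z" if "0 < q z" for z
        using that m0 m1 by (cases z) (auto simp: q_def perm_matrix_def zero_less_divide_iff split: if_splits)
      then show "{z \<in> A \<times> B. 0 < q z} \<subseteq> {z \<in> A \<times> B. 0 < p z}" by blast
      have "q (x0, f x0) = 0" using x0 by (simp add: q_def perm_matrix_def)
      then show "{z \<in> A \<times> B. 0 < q z} \<noteq> {z \<in> A \<times> B. 0 < p z}"
        using x0 fB pos by force
    qed
    have "q \<in> ?H"
    proof (rule less.hyps[OF _ qds])
      show "card {z \<in> A \<times> B. 0 < q z} < card {z \<in> A \<times> B. 0 < p z}"
        using fin sub by (intro psubset_card_mono) auto
    qed
    then have "m *\<^sub>R ?P + (1 - m) *\<^sub>R q \<in> ?H"
      using PH m0 m1 by (intro convexD[OF convex_convex_hull]) auto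
    moreover have "m *\<^sub>R ?P + (1 - m) *\<^sub>R q = p"
      using m1 by (auto simp: fun_eq_iff q_def)
    ultimately show ?thesis by simp
  qed
qed

section \<open>Direct sums of matroids of rank one\<close>

text \<open>
  Intersecting with a ground set recovers the summands of \<open>I \<union> J\<close>, so inclusion between independent
  sets of the direct sum, and with it maximality, can be tested in each component.
\<close>

lemma bases_direct_sum:
  assumes M: "matroid M" and N: "matroid N" and disj: "ground M \<inter> ground N = {}"
  shows "bases (direct_sum M N) = {I \<union> J | I J. I \<in> bases M \<and> J \<in> bases N}"
proof -
  have sub: "I \<subseteq> ground M" "J \<subseteq> ground N" if "I \<in> indeps M" "J \<in> indeps N" for I J
    using that M N by (auto simp: matroid_def)
  have part: "(I \<union> J) \<inter> ground M = I" "(I \<union> J) \<inter> ground N = J"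
    if "I \<in> indeps M" "J \<in> indeps N" for I J
    using sub[OF that] disj by blast+
  have subD: "I \<subseteq> I' \<and> J \<subseteq> J'"
    if "I \<union> J \<subseteq> I' \<union> J'" "I \<in> indeps M" "I' \<in> indeps M" "J \<in> indeps N" "J' \<in> indeps N" for I J I' J'
    using Int_mono[OF that(1) order_refl, of "ground M"] Int_mono[OF that(1) order_refl, of "ground N"]
      part[OF that(2,4)] part[OF that(3,5)] by simp
  show ?thesis
  proof (intro equalityI subsetI)
    fix K assume K: "K \<in> bases (direct_sum M N)"
    then obtain I J where IJ: "K = I \<union> J" "I \<in> indeps M" "J \<in> indeps N"
      by (auto simp: bases_def direct_sum_def)
    have max: "I' \<union> J' = I \<union> J"
      if "I' \<in> indeps M" "J' \<in> indeps N" "I \<union> J \<subseteq> I' \<union> J'" for I' J'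
      using K that unfolding IJ(1) by (auto simp: bases_def direct_sum_def)
    have "I' = I" if "I' \<in> indeps M" "I \<subseteq> I'" for I'
      using max[OF that(1) IJ(3)] that part(1)[OF that(1) IJ(3)] part(1)[OF IJ(2,3)] by auto
    then have "I \<in> bases M" using IJ by (auto simp: bases_def)
    moreover have "J' = J" if "J' \<in> indeps N" "J \<subseteq> J'" for J'
      using max[OF IJ(2) that(1)] that part(2)[OF IJ(2) that(1)] part(2)[OF IJ(2,3)] by auto
    then have "J \<in> bases N" using IJ by (auto simp: bases_def)
    ultimately show "K \<in> {I \<union> J | I J. I \<in> bases M \<and> J \<in> bases N}"
      using IJ(1) by blast
  next
    fix K assume "K \<in> {I \<union> J | I J. I \<in> bases M \<and> J \<in> bases N}"
    then obtain I J where IJ: "K = I \<union> J" "I \<in> bases M" "J \<in> bases N" by blast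
    then have ind: "I \<in> indeps M" "J \<in> indeps N" by (auto simp: bases_def)
    have "L = K" if L: "L \<in> indeps (direct_sum M N)" "K \<subseteq> L" for L
    proof -
      obtain I' J' where L': "L = I' \<union> J'" "I' \<in> indeps M" "J' \<in> indeps N"
        using L(1) by (auto simp: direct_sum_def)
      then have "I \<subseteq> I' \<and> J \<subseteq> J'" using subD L(2) ind IJ(1) by blast
      then have "I' = I" "J' = J" using IJ L' by (auto simp: bases_def)
      then show ?thesis using L' IJ by simp
    qed
    with ind IJ(1) show "K \<in> bases (direct_sum M N)"
      by (auto simp: bases_def direct_sum_def)
  qed
qed

lemma bases_direct_sum_rank_one:
  assumes "finite A" "finite B" "A \<noteq> {}" "B \<noteq> {}" "A \<inter> B = {}"
  shows "bases (direct_sum (uniform_matroid 1 A) (uniform_matroid 1 B)) =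
    (\<lambda>(x, y). {x, y}) ` (A \<times> B)"
proof -
  have one: "bases (uniform_matroid 1 S) = (\<lambda>x. {x}) ` S" if "finite S" "S \<noteq> {}" for S :: "'a set"
  proof -
    have "0 < card S" using that by (simp add: card_gt_0_iff)
    then have "bases (uniform_matroid 1 S) = {I. I \<subseteq> S \<and> card I = 1}"
      using that by (intro bases_uniform_matroid) auto
    then show ?thesis by (auto simp: card_1_singleton_iff)
  qed
  have "bases (direct_sum (uniform_matroid 1 A) (uniform_matroid 1 B)) =
      {I \<union> J | I J. I \<in> bases (uniform_matroid 1 A) \<and> J \<in> bases (uniform_matroid 1 B)}"
    using assms by (intro bases_direct_sum matroid_uniform_matroid) (auto simp: uniform_matroid_def)
  also have "\<dots> = (\<lambda>(x, y). {x, y}) ` (A \<times> B)"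
    unfolding one[OF assms(1,3)] one[OF assms(2,4)]
  proof (intro equalityI subsetI)
    fix K assume "K \<in> {I \<union> J | I J. I \<in> (\<lambda>x. {x}) ` A \<and> J \<in> (\<lambda>x. {x}) ` B}"
    then obtain x y where "x \<in> A" "y \<in> B" "K = {x} \<union> {y}" by blast
    then show "K \<in> (\<lambda>(x, y). {x, y}) ` (A \<times> B)"
      by (intro image_eqI[where x = "(x, y)"]) auto
  next
    fix K assume "K \<in> (\<lambda>(x, y). {x, y}) ` (A \<times> B)"
    then obtain x y where "x \<in> A" "y \<in> B" "K = {x, y}" by auto
    then show "K \<in> {I \<union> J | I J. I \<in> (\<lambda>x. {x}) ` A \<and> J \<in> (\<lambda>x. {x}) ` B}"
      by (intro CollectI exI[of _ "{x}"] exI[of _ "{y}"]) auto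
  qed
  finally show ?thesis .
qed

text \<open>
  The variance identity for numbers of mean \<open>1 / card S\<close>: the excess of the sum of squares over its
  minimum is the squared distance from the constant vector.
\<close>

lemma sum_squares_around_mean:
  fixes v :: "'a \<Rightarrow> real"
  assumes "finite S" "S \<noteq> {}" "sum v S = 1"
  shows "(\<Sum>x\<in>S. (v x)\<^sup>2) = 1 / card S + (\<Sum>x\<in>S. (v x - 1 / card S)\<^sup>2)"
proof -
  let ?k = "real (card S)"
  have k: "?k \<noteq> 0" using assms by simp
  have "(\<Sum>x\<in>S. (v x - 1 / ?k)\<^sup>2) = (\<Sum>x\<in>S. (v x)\<^sup>2 - 2 / ?k * v x + (1 / ?k)\<^sup>2)"
    by (intro sum.cong) (auto simp: power2_diff)
  also have "\<dots> = (\<Sum>x\<in>S. (v x)\<^sup>2) - 2 / ?k * sum v S + ?k * (1 / ?k)\<^sup>2"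
    by (simp only: sum.distrib sum_subtractf sum_distrib_left sum_constant)
  also have "\<dots> = (\<Sum>x\<in>S. (v x)\<^sup>2) - 1 / ?k"
    using assms(3) k by (simp add: power2_eq_square field_simps)
  finally show ?thesis by simp
qed

lemma sum_fun_apply: "(\<Sum>i\<in>I. g i) x = (\<Sum>i\<in>I. g i x)"
  by (induction I rule: infinite_finite_induct) simp_all

text \<open>
  Every point of the base polytope has coordinate sum \<open>1\<close> on \<open>A\<close> and on \<open>B\<close>, because every base meets
  each of them once. By the variance identity its energy is a constant plus its squared distance from
  the vector that is constant on each part, which is therefore the only possible minimizer. This vector
  lies in the polytope as the average of the indicators of all bases.
\<close>

lemma universal_density_direct_sum_rank_one:
  fixes A B :: "'a set"
  assumes fin: "finite A" "finite B" and ne: "A \<noteq> {}" "B \<noteq> {}" and disj: "A \<inter> B = {}"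
  shows "universal_density (direct_sum (uniform_matroid 1 A) (uniform_matroid 1 B)) =
    (\<lambda>e. if e \<in> A then 1 / card A else if e \<in> B then 1 / card B else 0)"
proof -
  let ?M = "direct_sum (uniform_matroid 1 A) (uniform_matroid 1 B)"
  let ?u = "\<lambda>e. if e \<in> A then 1 / card A else if e \<in> B then 1 / card B else (0::real)"
  let ?energy = "\<lambda>v :: 'a \<Rightarrow> real. \<Sum>e\<in>ground ?M. (v e)\<^sup>2"
  have poly: "base_polytope ?M = convex hull ((\<lambda>(x, y). indicator {x, y}) ` (A \<times> B))"
    unfolding base_polytope_def bases_direct_sum_rank_one[OF assms]
    by (simp add: image_image case_prod_unfold)
  define T where "T = {v :: 'a \<Rightarrow> real. sum v A = 1 \<and> sum v B = 1 \<and> (\<forall>e. e \<notin> A \<union> B \<longrightarrow> v e = 0)}"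
  have "convex T"
    by (rule convexI) (auto simp: T_def sum.distrib simp flip: sum_distrib_left)
  moreover have "indicator {x, y} \<in> T" if "x \<in> A" "y \<in> B" for x y
  proof -
    have "sum (indicator {x, y}) A = (\<Sum>e\<in>A. if e = x then 1 else (0::real))"
      "sum (indicator {x, y}) B = (\<Sum>e\<in>B. if e = y then 1 else (0::real))"
      using that disj by (auto simp: indicator_def intro!: sum.cong)
    then show ?thesis
      using that fin by (auto simp: T_def indicator_def)
  qed
  ultimately have inT: "base_polytope ?M \<subseteq> T"
    unfolding poly by (intro hull_minimal) auto
  have "(\<Sum>z\<in>A \<times> B. (1 / (card A * card B)) *\<^sub>R indicator {fst z, snd z}) \<in> base_polytope ?M"
    unfolding poly
  proof (rule convex_sum[OF _ convex_convex_hull])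
    show "(\<Sum>z\<in>A \<times> B. 1 / real (card A * card B)) = 1"
      using fin ne by (simp add: card_cartesian_product)
    show "indicator {fst z, snd z} \<in> convex hull ((\<lambda>(x, y). indicator {x, y}) ` (A \<times> B))"
      if "z \<in> A \<times> B" for z
      using that by (intro hull_inc image_eqI[where x = z]) (simp_all add: case_prod_unfold)
  qed (use fin in auto)
  also have "(\<Sum>z\<in>A \<times> B. (1 / (card A * card B)) *\<^sub>R indicator {fst z, snd z}) = ?u"
  proof
    fix e
    have "(\<Sum>z\<in>A \<times> B. (1 / (card A * card B)) *\<^sub>R indicator {fst z, snd z}) e =
        (\<Sum>z\<in>A \<times> B. indicator {fst z, snd z} e) / (card A * card B)"
      by (simp add: sum_fun_apply sum_divide_distrib)
    also have "(\<Sum>z\<in>A \<times> B. indicator {fst z, snd z} e :: real) =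
        card {z \<in> A \<times> B. e = fst z \<or> e = snd z}"
    proof -
      have "(\<Sum>z\<in>A \<times> B. indicator {fst z, snd z} e :: real) =
          (\<Sum>z\<in>A \<times> B. if e = fst z \<or> e = snd z then 1 else 0)"
        by (intro sum.cong) (auto simp: indicator_def)
      also have "\<dots> = card {z \<in> A \<times> B. e = fst z \<or> e = snd z}"
        using fin by (simp add: sum.If_cases Int_def)
      finally show ?thesis .
    qed
    also have "{z \<in> A \<times> B. e = fst z \<or> e = snd z} =
        (if e \<in> A then {e} \<times> B else if e \<in> B then A \<times> {e} else {})"
      using disj by auto
    also have "real (card \<dots>) / (card A * card B) = ?u e"
      using fin ne by (auto simp: card_cartesian_product)
    finally show "(\<Sum>z\<in>A \<times> B. (1 / (card A * card B)) *\<^sub>R indicator {fst z, snd z}) e = ?u e" .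
  qed
  finally have u: "?u \<in> base_polytope ?M" .
  have energy: "?energy v = 1 / card A + 1 / card B + (\<Sum>e\<in>A \<union> B. (v e - ?u e)\<^sup>2)" if "v \<in> T" for v
  proof -
    have *: "(\<Sum>e\<in>A. (v e - ?u e)\<^sup>2) = (\<Sum>e\<in>A. (v e - 1 / card A)\<^sup>2)"
      "(\<Sum>e\<in>B. (v e - ?u e)\<^sup>2) = (\<Sum>e\<in>B. (v e - 1 / card B)\<^sup>2)"
      using disj by (auto intro!: sum.cong)
    have "ground ?M = A \<union> B" by (simp add: direct_sum_def uniform_matroid_def)
    then show ?thesis
      using that sum_squares_around_mean[of A v] sum_squares_around_mean[of B v] assms *
      by (simp add: T_def sum.union_disjoint)
  qed
  have energy_u: "?energy ?u = 1 / card A + 1 / card B"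
    using energy[of ?u] u inT by auto
  show ?thesis
    unfolding universal_density_def
  proof (rule the_equality)
    show "is_arg_min ?energy (\<lambda>v. v \<in> base_polytope ?M) ?u"
      unfolding is_arg_min_def energy_u
    proof (intro conjI notI u)
      assume "\<exists>v. v \<in> base_polytope ?M \<and> ?energy v < 1 / card A + 1 / card B"
      then obtain v where v: "v \<in> T" "?energy v < 1 / card A + 1 / card B" using inT by blast
      have "0 \<le> (\<Sum>e\<in>A \<union> B. (v e - ?u e)\<^sup>2)" by (intro sum_nonneg) auto
      with v(2) energy[OF v(1)] show False by linarith
    qed
  next
    fix v assume "is_arg_min ?energy (\<lambda>v. v \<in> base_polytope ?M) v"
    then have v: "v \<in> T" "?energy v \<le> ?energy ?u"
      using u inT by (auto simp: is_arg_min_def not_less)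
    then have "(\<Sum>e\<in>A \<union> B. (v e - ?u e)\<^sup>2) \<le> 0"
      using energy[OF v(1)] energy_u by linarith
    moreover have "0 \<le> (\<Sum>e\<in>A \<union> B. (v e - ?u e)\<^sup>2)" by (intro sum_nonneg) auto
    ultimately have "(\<Sum>e\<in>A \<union> B. (v e - ?u e)\<^sup>2) = 0" by linarith
    then have "\<forall>e\<in>A \<union> B. v e = ?u e"
      using fin by (subst (asm) sum_nonneg_eq_0_iff) auto
    then show "v = ?u" using v(1) by (auto simp: T_def)
  qed
qed

section \<open>Mass functions on pairs\<close>

lemma inj_on_doubleton:
  assumes "A \<inter> B = {}"
  shows "inj_on (\<lambda>(x, y). {x, y}) (A \<times> B)"
  using assms by (auto simp: inj_on_def doubleton_eq_iff)

text \<open>The usages of an element of \<open>A\<close> and of \<open>B\<close> as row and column sums.\<close>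

lemma sum_pairs_containing:
  fixes g :: "'a set \<Rightarrow> real"
  assumes "A \<inter> B = {}"
  shows "x \<in> A \<Longrightarrow> (\<Sum>\<gamma>\<in>{\<gamma> \<in> (\<lambda>(x, y). {x, y}) ` (A \<times> B). x \<in> \<gamma>}. g \<gamma>) = (\<Sum>y\<in>B. g {x, y})"
    and "y \<in> B \<Longrightarrow> (\<Sum>\<gamma>\<in>{\<gamma> \<in> (\<lambda>(x, y). {x, y}) ` (A \<times> B). y \<in> \<gamma>}. g \<gamma>) = (\<Sum>x\<in>A. g {x, y})"
proof -
  assume x: "x \<in> A"
  have "{\<gamma> \<in> (\<lambda>(x, y). {x, y}) ` (A \<times> B). x \<in> \<gamma>} = (\<lambda>y. {x, y}) ` B"
    using x assms by force
  moreover have "inj_on (\<lambda>y. {x, y}) B" by (auto simp: inj_on_def doubleton_eq_iff)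
  ultimately show "(\<Sum>\<gamma>\<in>{\<gamma> \<in> (\<lambda>(x, y). {x, y}) ` (A \<times> B). x \<in> \<gamma>}. g \<gamma>) = (\<Sum>y\<in>B. g {x, y})"
    by (simp add: sum.reindex)
next
  assume y: "y \<in> B"
  have "{\<gamma> \<in> (\<lambda>(x, y). {x, y}) ` (A \<times> B). y \<in> \<gamma>} = (\<lambda>x. {x, y}) ` A"
    using y assms by force
  moreover have "inj_on (\<lambda>x. {x, y}) A" by (auto simp: inj_on_def doubleton_eq_iff)
  ultimately show "(\<Sum>\<gamma>\<in>{\<gamma> \<in> (\<lambda>(x, y). {x, y}) ` (A \<times> B). y \<in> \<gamma>}. g \<gamma>) = (\<Sum>x\<in>A. g {x, y})"
    by (simp add: sum.reindex)
qed

lemma pmf_matching_pmf: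
  assumes "finite A" "A \<noteq> {}" "A \<inter> B = {}" "f ` A \<subseteq> B"
  shows "pmf (matching_pmf A f) \<gamma> = (if \<exists>x\<in>A. \<gamma> = {x, f x} then 1 / card A else 0)"
proof -
  have S: "{{x, f x} | x. x \<in> A} = (\<lambda>x. {x, f x}) ` A" by auto
  have "inj_on (\<lambda>x. {x, f x}) A"
    using assms(3,4) by (auto simp: inj_on_def doubleton_eq_iff)
  then show ?thesis
    using assms(1,2) unfolding matching_pmf_def S
    by (simp add: card_image indicator_def image_iff)
qed

lemma induces_uniform_iff_doubly_stochastic:
  fixes \<mu> :: "'a set pmf"
  assumes disj: "A \<inter> B = {}" and n: "0 < n"
  shows "induces (A \<union> B) ((\<lambda>(x, y). {x, y}) ` (A \<times> B)) \<mu> (\<lambda>e. 1 / real n) \<longleftrightarrow>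
    doubly_stochastic A B (\<lambda>(x, y). if x \<in> A \<and> y \<in> B then n * pmf \<mu> {x, y} else 0)"
    (is "_ \<longleftrightarrow> doubly_stochastic A B ?p")
proof -
  have scale: "(\<Sum>i\<in>I. real n * h i) = 1 \<longleftrightarrow> sum h I = 1 / real n" for h :: "'a \<Rightarrow> real" and I
    using n by (auto simp: field_simps simp flip: sum_distrib_left)
  have "doubly_stochastic A B ?p \<longleftrightarrow>
      (\<forall>x\<in>A. (\<Sum>y\<in>B. pmf \<mu> {x, y}) = 1 / real n) \<and> (\<forall>y\<in>B. (\<Sum>x\<in>A. pmf \<mu> {x, y}) = 1 / real n)"
    by (auto simp: doubly_stochastic_def scale)
  also have "\<dots> \<longleftrightarrow> induces (A \<union> B) ((\<lambda>(x, y). {x, y}) ` (A \<times> B)) \<mu> (\<lambda>e. 1 / real n)"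
    unfolding induces_def ball_Un
    by (simp add: sum_pairs_containing[OF disj])
  finally show ?thesis by blast
qed

text \<open>
  The linear map that turns a matrix into a function on pairs and divides it by \<open>card A\<close> takes
  permutation matrices to the matching mass functions. Linear maps commute with convex hulls, so the
  theorem on doubly stochastic matrices decomposes every \<open>\<mu>\<close> that induces the constant density.
  Conversely, the functions with prescribed usages form a convex set that contains the matching mass
  functions.
\<close>

lemma induces_uniform_iff_in_hull:
  fixes A B :: "'a set"
  assumes fin: "finite A" "finite B" and ne: "A \<noteq> {}" and disj: "A \<inter> B = {}"
    and \<mu>: "set_pmf \<mu> \<subseteq> (\<lambda>(x, y). {x, y}) ` (A \<times> B)"
  shows "induces (A \<union> B) ((\<lambda>(x, y). {x, y}) ` (A \<times> B)) \<mu> (\<lambda>e. 1 / real (card A)) \<longleftrightarrow>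
    pmf \<mu> \<in> convex hull ((\<lambda>f. pmf (matching_pmf A f)) ` {f. bij_betw f A B})"
    (is "?ind \<mu> \<longleftrightarrow> _ \<in> convex hull (_ ` ?F)")
proof -
  let ?\<Gamma> = "(\<lambda>(x, y). {x, y}) ` (A \<times> B)" and ?n = "card A"
  have n: "0 < ?n" using fin ne by (simp add: card_gt_0_iff)
  \<comment> \<open>The inverse on pairs picks the representation whose first component lies in \<open>A\<close>.\<close>
  define L :: "('a \<times> 'a \<Rightarrow> real) \<Rightarrow> 'a set \<Rightarrow> real" where
    "L q = (\<lambda>\<gamma>. if \<gamma> \<in> ?\<Gamma> then q (inv_into (A \<times> B) (\<lambda>(x, y). {x, y}) \<gamma>) / ?n else 0)" for q
  have L_pair: "L q {x, y} = q (x, y) / ?n" if "x \<in> A" "y \<in> B" for q x y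
  proof -
    have "inv_into (A \<times> B) (\<lambda>(x, y). {x, y}) {x, y} = (x, y)"
      using inv_into_f_f[OF inj_on_doubleton[OF disj], of "(x, y)"] that by simp
    then show ?thesis using that by (force simp: L_def)
  qed
  have L_out: "L q \<gamma> = 0" if "\<gamma> \<notin> ?\<Gamma>" for q \<gamma>
    using that by (simp add: L_def)
  have "linear L"
    by (rule linearI) (auto simp: L_def fun_eq_iff add_divide_distrib)
  have L_perm: "L (perm_matrix A f) = pmf (matching_pmf A f)" if f: "bij_betw f A B" for f
  proof
    fix \<gamma>
    have fB: "f ` A \<subseteq> B" using f by (simp add: bij_betw_def)
    show "L (perm_matrix A f) \<gamma> = pmf (matching_pmf A f) \<gamma>"
    proof (cases "\<gamma> \<in> ?\<Gamma>")
      case True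
      then obtain x y where xy: "x \<in> A" "y \<in> B" "\<gamma> = {x, y}" by auto
      have "(\<exists>x'\<in>A. {x, y} = {x', f x'}) \<longleftrightarrow> y = f x"
        using xy fB disj by (auto simp: doubleton_eq_iff)
      then show ?thesis
        using xy by (simp add: L_pair perm_matrix_def pmf_matching_pmf[OF fin(1) ne disj fB])
    next
      case False
      then have "\<not> (\<exists>x\<in>A. \<gamma> = {x, f x})" using fB by force
      then show ?thesis
        using False by (simp add: L_out pmf_matching_pmf[OF fin(1) ne disj fB])
    qed
  qed
  have hull: "convex hull ((\<lambda>f. pmf (matching_pmf A f)) ` ?F) = L ` (convex hull (perm_matrix A ` ?F))"
    using L_perm by (simp add: convex_hull_linear_image[OF \<open>linear L\<close>] image_image)
  show ?thesis
  proof
    assume "?ind \<mu>"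
    then have "doubly_stochastic A B (\<lambda>(x, y). if x \<in> A \<and> y \<in> B then ?n * pmf \<mu> {x, y} else 0)"
      (is "doubly_stochastic A B ?p")
      using induces_uniform_iff_doubly_stochastic[OF disj n] by blast
    then have in_hull: "?p \<in> convex hull (perm_matrix A ` ?F)"
      by (rule birkhoff_von_neumann[OF fin])
    have L_p: "L ?p = pmf \<mu>"
    proof
      fix \<gamma> show "L ?p \<gamma> = pmf \<mu> \<gamma>"
      proof (cases "\<gamma> \<in> ?\<Gamma>")
        case True
        then obtain x y where "x \<in> A" "y \<in> B" "\<gamma> = {x, y}" by auto
        then show ?thesis using n by (simp add: L_pair)
      next
        case False
        then have "\<gamma> \<notin> set_pmf \<mu>" using \<mu> by blast
        then show ?thesis using False by (simp add: L_out pmf_eq_0_set_pmf)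
      qed
    qed
    show "pmf \<mu> \<in> convex hull ((\<lambda>f. pmf (matching_pmf A f)) ` ?F)"
      using imageI[OF in_hull, of L] unfolding hull L_p .
  next
    define C where "C = {v :: 'a set \<Rightarrow> real. \<forall>e\<in>A \<union> B. (\<Sum>\<gamma>\<in>{\<gamma> \<in> ?\<Gamma>. e \<in> \<gamma>}. v \<gamma>) = 1 / ?n}"
    have "convex C"
    proof (rule convexI)
      fix v w :: "'a set \<Rightarrow> real" and s t :: real
      assume *: "v \<in> C" "w \<in> C" "0 \<le> s" "0 \<le> t" "s + t = 1"
      have "(\<Sum>\<gamma>\<in>{\<gamma> \<in> ?\<Gamma>. e \<in> \<gamma>}. (s *\<^sub>R v + t *\<^sub>R w) \<gamma>) = 1 / ?n" if e: "e \<in> A \<union> B" for e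
      proof -
        have "(\<Sum>\<gamma>\<in>{\<gamma> \<in> ?\<Gamma>. e \<in> \<gamma>}. (s *\<^sub>R v + t *\<^sub>R w) \<gamma>) =
            s * (\<Sum>\<gamma>\<in>{\<gamma> \<in> ?\<Gamma>. e \<in> \<gamma>}. v \<gamma>) + t * (\<Sum>\<gamma>\<in>{\<gamma> \<in> ?\<Gamma>. e \<in> \<gamma>}. w \<gamma>)"
          by (simp add: sum.distrib sum_distrib_left)
        also have "\<dots> = (s + t) * (1 / ?n)"
          using *(1,2) e by (simp add: C_def add_divide_distrib)
        finally show ?thesis using * by simp
      qed
      then show "s *\<^sub>R v + t *\<^sub>R w \<in> C" by (simp add: C_def)
    qed
    moreover have "pmf (matching_pmf A f) \<in> C" if f: "bij_betw f A B" for f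
    proof -
      have fB: "f ` A \<subseteq> B" using f by (simp add: bij_betw_def)
      have "(\<lambda>(x, y). if x \<in> A \<and> y \<in> B then ?n * pmf (matching_pmf A f) {x, y} else 0) = perm_matrix A f"
        using fB n L_pair[of _ _ "perm_matrix A f"] unfolding L_perm[OF f]
        by (auto simp: fun_eq_iff perm_matrix_def)
      then have "?ind (matching_pmf A f)"
        using doubly_stochastic_perm_matrix[OF fin f]
        by (simp add: induces_uniform_iff_doubly_stochastic[OF disj n])
      then show ?thesis by (simp add: C_def induces_def)
    qed
    ultimately have "convex hull ((\<lambda>f. pmf (matching_pmf A f)) ` ?F) \<subseteq> C"
      by (intro hull_minimal) auto
    moreover assume "pmf \<mu> \<in> convex hull ((\<lambda>f. pmf (matching_pmf A f)) ` ?F)"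
    ultimately show "?ind \<mu>" by (auto simp: C_def induces_def)
  qed
qed

theorem theorem6p9:
  fixes a b :: "nat \<Rightarrow> 'a" and n :: nat and A B E :: "'a set"
    and M N :: "'a matroid_data" and \<Gamma> :: "'a set set" and \<eta> :: "'a \<Rightarrow> real"
    and F :: "('a \<Rightarrow> 'a) set"
  assumes "n \<ge> 1"
    and "inj_on a {1..n}" and "inj_on b {1..n}"
    and "A = a ` {1..n}" and "B = b ` {1..n}" and "A \<inter> B = {}"
    and "E = A \<union> B"
    and "M = uniform_matroid 1 A" and "N = uniform_matroid 1 B"
    and "\<Gamma> = bases (direct_sum M N)"
    and "\<eta> = universal_density (direct_sum M N)"
    and "F = {f. bij_betw f A B}"
  shows "\<Gamma> = {{a i, b j} | i j. i \<in> {1..n} \<and> j \<in> {1..n}} \<and>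
    (\<forall>e\<in>E. \<eta> e = 1 / real n) \<and>
    (\<forall>\<mu>\<in>pmfs_on \<Gamma>.
      induces E \<Gamma> \<mu> \<eta> \<longleftrightarrow> pmf \<mu> \<in> convex hull ((\<lambda>f. pmf (matching_pmf A f)) ` F))"
proof -
  have fin: "finite A" "finite B" and ne: "A \<noteq> {}" "B \<noteq> {}"
    using assms(1,4,5) by auto
  have card: "card A = n" "card B = n"
    using assms(2-5) by (simp_all add: card_image)
  have \<Gamma>: "\<Gamma> = (\<lambda>(x, y). {x, y}) ` (A \<times> B)"
    unfolding assms(8-10) by (rule bases_direct_sum_rank_one[OF fin ne assms(6)])
  have "\<Gamma> = {{a i, b j} | i j. i \<in> {1..n} \<and> j \<in> {1..n}}"
    unfolding \<Gamma> assms(4,5) by force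
  moreover have \<eta>: "\<forall>e\<in>E. \<eta> e = 1 / real n"
    unfolding assms(7-9,11) universal_density_direct_sum_rank_one[OF fin ne assms(6)] card by auto
  moreover have "induces E \<Gamma> \<mu> \<eta> \<longleftrightarrow> pmf \<mu> \<in> convex hull ((\<lambda>f. pmf (matching_pmf A f)) ` F)"
    if "\<mu> \<in> pmfs_on \<Gamma>" for \<mu>
  proof -
    have "induces E \<Gamma> \<mu> \<eta> \<longleftrightarrow> induces (A \<union> B) \<Gamma> \<mu> (\<lambda>e. 1 / real (card A))"
      using \<eta> by (simp add: induces_def card assms(7))
    also have "\<dots> \<longleftrightarrow> pmf \<mu> \<in> convex hull ((\<lambda>f. pmf (matching_pmf A f)) ` F)"
      using that unfolding \<Gamma> assms(12) pmfs_on_def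
      by (intro induces_uniform_iff_in_hull[OF fin ne(1) assms(6)]) auto
    finally show ?thesis .
  qed
  ultimately show ?thesis by blast
qed

end
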